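(* For interval selection with proportional weights, for every instance, every arrival order, every fixed optimal solution used as reference, and every assignment of binary predictions with total error $\eta$ (measured with respect to that optimal solution), Algorithm Naive outputs a set of pairwise disjoint intervals of total weight $ALG \geq OPT - \eta$.
   Context: Interval selection: an instance is a finite nonempty set $\mathcal{I}$ of intervals $[s_i,f_i)$ on the real line, $s_i<f_i$, arriving one at a time in an arbitrary (adversarial) order. Two intervals conflict if they intersect. Each interval $I$ has a weight $w(I)$; proportional weights means $w([s,f))=f-s$. The goal is to output a set of pairwise disjoint intervals of maximum total weight. $OPT$ denotes the maximum total weight of a set of pairwise disjoint intervals of the instance, and $ALG$ the total weight of the algorithm's final solution. Predictions: each interval $I$ arrives together with a bit $Prd(I)\in\{0,1\}$; $Prd(I)=1$ means $I$ is predicted to belong to a fixed optimal solution $O$, and $Prd(I)=0$ means it is predicted not to belong to $O$. The prediction of $I$ is accurate if ($Prd(I)=1 \iff I\in O$). Predictions may be arbitrary. Error (with respect to $O$, which may be any optimal solution): $\eta(I)=0$ if the prediction of $I$ is accurate; $\eta(I)=w(I)$ if $I\in O$ and $Prd(I)=0$; $\eta(I)=\sum_{J\in\mathcal{C}}w(J)-w(I)$ if $I\notin O$ and $Prd(I)=1$, where $\mathcal{C}$ is the set of intervals of $O$ that conflict with $I$. The total error is $\eta=\sum_{I\in\mathcal{I}}\eta(I)$. Algorithm Naive: start with an empty solution; on the arrival of $I$, accept $I$ (irrevocably) if and only if $Prd(I)=1$ and $I$ conflicts with no interval currently in the solution. *)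

theory Defs
  imports Complex_Main
begin

text \<open>The pair \<open>(s, f)\<close> encodes the half-open interval \<open>[s, f)\<close>; the encoding is
  injective on the pairs with \<open>s < f\<close>, which are the only ones admitted by \<open>is_instance\<close>.\<close>

type_synonym interval = "real \<times> real"

definition points :: "interval \<Rightarrow> real set" where
  "points I = {fst I..<snd I}"

definition conflict :: "interval \<Rightarrow> interval \<Rightarrow> bool" where
  "conflict I J \<longleftrightarrow> points I \<inter> points J \<noteq> {}"

definition pairwise_disjoint :: "interval set \<Rightarrow> bool" where
  "pairwise_disjoint S \<longleftrightarrow> pairwise (\<lambda>I J. \<not> conflict I J) S"

definition is_instance :: "interval set \<Rightarrow> bool" where
  "is_instance \<I> \<longleftrightarrow> finite \<I> \<and> \<I> \<noteq> {} \<and> (\<forall>I\<in>\<I>. fst I < snd I)"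

definition arrival_order :: "interval list \<Rightarrow> interval set \<Rightarrow> bool" where
  "arrival_order xs \<I> \<longleftrightarrow> distinct xs \<and> set xs = \<I>"

definition proportional_weight :: "interval \<Rightarrow> real" where
  "proportional_weight I = snd I - fst I"

definition feasible :: "interval set \<Rightarrow> interval set \<Rightarrow> bool" where
  "feasible \<I> S \<longleftrightarrow> S \<subseteq> \<I> \<and> pairwise_disjoint S"

definition OPT :: "(interval \<Rightarrow> real) \<Rightarrow> interval set \<Rightarrow> real" where
  "OPT w \<I> = Max {sum w S | S. feasible \<I> S}"

definition optimal_solution :: "(interval \<Rightarrow> real) \<Rightarrow> interval set \<Rightarrow> interval set \<Rightarrow> bool" where
  "optimal_solution w \<I> Opt \<longleftrightarrow> feasible \<I> Opt \<and> sum w Opt = OPT w \<I>"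

text \<open>A prediction bit is a truth value, \<open>True\<close> standing for \<open>1\<close>.\<close>

type_synonym prediction = "interval \<Rightarrow> bool"

definition accurate :: "interval set \<Rightarrow> prediction \<Rightarrow> interval \<Rightarrow> bool" where
  "accurate Opt Prd I \<longleftrightarrow> (Prd I \<longleftrightarrow> I \<in> Opt)"

definition interval_error ::
  "(interval \<Rightarrow> real) \<Rightarrow> interval set \<Rightarrow> prediction \<Rightarrow> interval \<Rightarrow> real" where
  "interval_error w Opt Prd I =
    (if accurate Opt Prd I then 0
     else if I \<in> Opt then w I
     else (\<Sum>J\<in>{J \<in> Opt. conflict I J}. w J) - w I)"

definition total_error ::
  "(interval \<Rightarrow> real) \<Rightarrow> interval set \<Rightarrow> interval set \<Rightarrow> prediction \<Rightarrow> real" where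
  "total_error w \<I> Opt Prd = (\<Sum>I\<in>\<I>. interval_error w Opt Prd I)"

text \<open>The online algorithm sees the arrivals one by one, each with its prediction bit; its
  decision depends only on the current solution and the current arrival.\<close>

definition naive_step :: "interval set \<Rightarrow> interval \<times> bool \<Rightarrow> interval set" where
  "naive_step S = (\<lambda>(I, b). if b \<and> (\<forall>J\<in>S. \<not> conflict I J) then insert I S else S)"

definition naive :: "(interval \<times> bool) list \<Rightarrow> interval set" where
  "naive arrivals = foldl naive_step {} arrivals"

end

theory Submission
  imports Defs
begin

text \<open>By optimality every \<open>I \<notin> Opt\<close> weighs at most its conflict set in \<open>Opt\<close>, so all errors are
  nonnegative and those of rejected intervals outside \<open>Opt\<close> may be dropped. For an accepted
  \<open>I \<notin> Opt\<close>, weight plus error is the total weight of the members of \<open>Opt\<close> it conflicts with.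
  Every member of \<open>Opt\<close> is thus paid for: if predicted \<open>0\<close>, by its own error; if accepted, by
  itself; otherwise by an accepted interval blocking it, which lies outside \<open>Opt\<close> because \<open>Opt\<close>
  is pairwise disjoint.\<close>

lemma conflict_commute: "conflict I J \<longleftrightarrow> conflict J I"
  by (auto simp: conflict_def)

lemma naive_snoc:
  "naive (map (\<lambda>I. (I, Prd I)) (xs @ [x])) =
    naive_step (naive (map (\<lambda>I. (I, Prd I)) xs)) (x, Prd x)"
  by (simp add: naive_def)

lemma naive_subset: "naive (map (\<lambda>I. (I, Prd I)) xs) \<subseteq> {I \<in> set xs. Prd I}"
proof (induction xs rule: rev_induct)
  case Nil
  then show ?case by (simp add: naive_def)
next
  case (snoc x xs)
  then show ?case unfolding naive_snoc by (auto simp: naive_step_def)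
qed

lemma naive_pairwise_disjoint: "pairwise_disjoint (naive (map (\<lambda>I. (I, Prd I)) xs))"
proof (induction xs rule: rev_induct)
  case Nil
  then show ?case by (simp add: naive_def pairwise_disjoint_def)
next
  case (snoc x xs)
  then show ?case unfolding naive_snoc
    by (auto simp: naive_step_def pairwise_disjoint_def pairwise_insert conflict_commute)
qed

text \<open>Acceptance is irrevocable: whatever blocks \<open>J\<close> on its arrival is still
  there at the end.\<close>

lemma naive_maximal:
  assumes "J \<in> set xs" "Prd J"
  shows "J \<in> naive (map (\<lambda>I. (I, Prd I)) xs) \<or>
    (\<exists>I\<in>naive (map (\<lambda>I. (I, Prd I)) xs). conflict I J)"
  using assms
proof (induction xs rule: rev_induct)
  case Nil
  then show ?case by simp
next
  case (snoc x xs)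
  then show ?case unfolding naive_snoc by (auto simp: naive_step_def conflict_commute)
qed

lemma sum_le_OPT:
  assumes "finite \<I>" "feasible \<I> S"
  shows "sum w S \<le> OPT w \<I>"
proof -
  \<comment> \<open>\<open>Max\<close> bounds its elements only over a finite set; finiteness comes
    from feasible sets being subsets of the finite \<open>\<I>\<close>.\<close>
  have "{sum w S | S. feasible \<I> S} \<subseteq> sum w ` Pow \<I>"
    by (auto simp: feasible_def)
  then have "finite {sum w S | S. feasible \<I> S}"
    using assms(1) by (meson finite_Pow_iff finite_imageI finite_subset)
  then show ?thesis
    unfolding OPT_def using assms(2) by (intro Max_ge) auto
qed

text \<open>Exchange argument: trading the conflict set of \<open>I\<close> for \<open>I\<close>
  itself keeps \<open>Opt\<close> feasible, so it cannot raise the weight above the optimum.\<close>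

lemma weight_le_conflicts:
  assumes "finite \<I>" "optimal_solution w \<I> Opt" "I \<in> \<I>" "I \<notin> Opt"
  shows "w I \<le> sum w {J \<in> Opt. conflict I J}"
proof -
  let ?C = "{J \<in> Opt. conflict I J}"
  have feas: "feasible \<I> Opt" and opt: "sum w Opt = OPT w \<I>"
    using assms(2) by (auto simp: optimal_solution_def)
  have fin: "finite Opt"
    using feas assms(1) by (auto simp: feasible_def intro: finite_subset)
  have "feasible \<I> (insert I (Opt - ?C))"
    using feas assms(3)
    by (auto simp: feasible_def pairwise_disjoint_def pairwise_def conflict_commute)
  from sum_le_OPT[OF assms(1) this, of w]
  have "w I + sum w (Opt - ?C) \<le> sum w Opt"
    using fin assms(4) opt by simp
  then show ?thesis
    using fin by (simp add: sum_diff)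
qed

lemma interval_error_nonneg:
  assumes "finite \<I>" "optimal_solution w \<I> Opt" "I \<in> \<I>" "0 \<le> w I"
  shows "0 \<le> interval_error w Opt Prd I"
  using assms weight_le_conflicts[OF assms(1-3)] by (auto simp: interval_error_def)

text \<open>The charging argument, for any weight that is nonnegative on the instance; interval
  lengths enter the theorem only through their sign.\<close>

lemma OPT_le_naive_plus_error:
  fixes Prd :: prediction and xs :: "interval list"
  assumes fin: "finite \<I>" and nonneg: "\<And>I. I \<in> \<I> \<Longrightarrow> 0 \<le> w I"
    and "set xs = \<I>" and opt: "optimal_solution w \<I> Opt"
  defines "A \<equiv> naive (map (\<lambda>I. (I, Prd I)) xs)"
  shows "OPT w \<I> \<le> sum w A + total_error w \<I> Opt Prd"
proof -
  define C where "C I = {J \<in> Opt. conflict I J}" for I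
  define M where "M = {J \<in> Opt. \<not> Prd J}"
  have Opt: "Opt \<subseteq> \<I>" "pairwise_disjoint Opt" "sum w Opt = OPT w \<I>"
    using opt by (auto simp: optimal_solution_def feasible_def)
  have A: "A \<subseteq> {I \<in> \<I>. Prd I}"
    using naive_subset[of Prd xs] assms(3) by (simp add: A_def)
  have fins: "finite A" "finite Opt" "finite M" "\<And>I. finite (C I)"
    using fin A Opt(1) by (auto simp: M_def C_def intro: finite_subset)
  have cover: "Opt \<subseteq> M \<union> (A \<inter> Opt) \<union> (\<Union>I\<in>A - Opt. C I)"
  proof
    fix J assume J: "J \<in> Opt"
    show "J \<in> M \<union> (A \<inter> Opt) \<union> (\<Union>I\<in>A - Opt. C I)"
    proof (cases "Prd J \<and> J \<notin> A")
      case True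
      have "J \<in> set xs"
        using J Opt(1) assms(3) by auto
      with True obtain I where I: "I \<in> A" "conflict I J"
        using naive_maximal[of J xs Prd] unfolding A_def by blast
      \<comment> \<open>\<open>I\<close> and \<open>J\<close> are distinct, since only
        \<open>I\<close> lies in \<open>A\<close>; two distinct members of \<open>Opt\<close> cannot
        conflict.\<close>
      with True J Opt(2) have "I \<notin> Opt"
        by (auto simp: pairwise_disjoint_def pairwise_def)
      with I J show ?thesis by (auto simp: C_def)
    qed (use J in \<open>auto simp: M_def\<close>)
  qed
  have pos: "\<And>J. J \<in> Opt \<Longrightarrow> 0 \<le> w J"
    using nonneg Opt(1) by auto
  have sub: "M \<subseteq> Opt" "\<And>I J. J \<in> C I \<Longrightarrow> J \<in> Opt"
    by (auto simp: M_def C_def)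
  \<comment> \<open>From the cover to a sum of weights: the sets \<open>C I\<close> may overlap, as
    one member of \<open>Opt\<close> can conflict with several accepted intervals. Nonnegative
    weights make this overcounting harmless.\<close>
  have "sum w Opt \<le> sum w (M \<union> (A \<inter> Opt) \<union> (\<Union>I\<in>A - Opt. C I))"
    using fins sub by (intro sum_mono2 cover) (auto intro!: pos)
  also have "\<dots> \<le> sum w (M \<union> (A \<inter> Opt)) + sum w (\<Union>I\<in>A - Opt. C I)"
    using fins sub by (subst sum_Un) (auto intro!: sum_nonneg pos)
  also have "\<dots> \<le> sum w M + sum w (A \<inter> Opt) + (\<Sum>I\<in>A - Opt. sum w (C I))"
  proof (rule add_mono)
    show "sum w (M \<union> (A \<inter> Opt)) \<le> sum w M + sum w (A \<inter> Opt)"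
      using fins sub by (subst sum_Un) (auto intro!: sum_nonneg pos)
    \<comment> \<open>\<open>Sigma\<close> is the disjoint union of the sets \<open>C I\<close>.
      Projecting it to the second component merges repeated copies of an interval, which can only
      lower the total.\<close>
    have "sum w (\<Union>I\<in>A - Opt. C I) \<le> sum w (snd ` Sigma (A - Opt) C)"
      by (rule eq_refl) (rule arg_cong[where f = "sum w"], force)
    also have "\<dots> \<le> sum (w \<circ> snd) (Sigma (A - Opt) C)"
      using fins sub by (intro sum_image_le) (auto intro!: pos)
    also have "\<dots> = (\<Sum>I\<in>A - Opt. sum w (C I))"
      using fins by (simp add: sum.Sigma case_prod_beta comp_def)
    finally show "sum w (\<Union>I\<in>A - Opt. C I) \<le> (\<Sum>I\<in>A - Opt. sum w (C I))" .
  qed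
  finally have paid:
    "sum w Opt \<le> sum w M + sum w (A \<inter> Opt) + (\<Sum>I\<in>A - Opt. sum w (C I))" .
  have "sum w M = sum (interval_error w Opt Prd) M"
    by (rule sum.cong) (auto simp: M_def interval_error_def accurate_def)
  moreover have "(\<Sum>I\<in>A - Opt. sum w (C I)) =
      (\<Sum>I\<in>A - Opt. interval_error w Opt Prd I + w I)"
    using A by (intro sum.cong) (auto simp: C_def interval_error_def accurate_def)
  moreover have "sum w A = sum w (A \<inter> Opt) + sum w (A - Opt)"
    using fins(1) by (rule sum.Int_Diff)
  \<comment> \<open>\<open>M\<close> lies inside \<open>Opt\<close>, so it is disjoint from
    \<open>A - Opt\<close> and no error is charged twice.\<close>
  moreover have "sum (interval_error w Opt Prd) M + sum (interval_error w Opt Prd) (A - Opt) =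
      sum (interval_error w Opt Prd) (M \<union> (A - Opt))"
    using fins by (subst sum.union_disjoint) (auto simp: M_def)
  moreover have "\<dots> \<le> total_error w \<I> Opt Prd"
    unfolding total_error_def using fin A Opt(1) nonneg interval_error_nonneg[OF fin opt]
    by (intro sum_mono2) (auto simp: M_def)
  \<comment> \<open>The weights of \<open>A \<inter> Opt\<close> and \<open>A - Opt\<close>
    recombine to that of \<open>A\<close>; what is left of the bound is error.\<close>
  ultimately show ?thesis
    using paid Opt(3) by (simp add: sum.distrib)
qed

theorem theorem3p5:
  fixes \<I> Opt :: "interval set" and xs :: "interval list" and Prd :: prediction
  assumes "is_instance \<I>"
    and "arrival_order xs \<I>"
    and "optimal_solution proportional_weight \<I> Opt"
  defines "A \<equiv> naive (map (\<lambda>I. (I, Prd I)) xs)"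
  shows "feasible \<I> A \<and>
    sum proportional_weight A
      \<ge> OPT proportional_weight \<I> - total_error proportional_weight \<I> Opt Prd"
proof
  have xs: "set xs = \<I>" and fin: "finite \<I>"
    and nonneg: "\<And>I. I \<in> \<I> \<Longrightarrow> 0 \<le> proportional_weight I"
    using assms(1,2) by (auto simp: arrival_order_def is_instance_def proportional_weight_def
        intro: less_imp_le)
  show "feasible \<I> A"
    using naive_subset[of Prd xs] naive_pairwise_disjoint[of Prd xs] xs
    by (auto simp: A_def feasible_def)
  show "sum proportional_weight A
      \<ge> OPT proportional_weight \<I> - total_error proportional_weight \<I> Opt Prd"
    using OPT_le_naive_plus_error[OF fin nonneg xs assms(3), of Prd] by (simp add: A_def)
qed

end
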